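(* Let $d,m\ge 1$ be integers, $n=d+m$, let $A=\begin{pmatrix}\bm{\beta}\\ A'\end{pmatrix}\in\mathbb{R}^{(d+1)\times m}$ with $\bm{\beta}\in\mathbb{R}^m$ and $A'\in\mathbb{R}^{d\times m}$, and let $\mathcal{L}=\{(\bm{x},\widetilde{\bm{x}}A)\mid \bm{x}\in\mathbb{R}^d\}\subset\mathbb{R}^n$, where $\widetilde{\bm{x}}=(1,\bm{x})$. Then $\mathcal{L}$ is of strong Khintchine type for convergence if $\omega(A')<n$.
   Context: Vectors are row vectors; $|\cdot|$ is the supremum norm; $\|\bm{y}\|$ is the sup-norm distance of $\bm{y}$ to the nearest integer vector (also for column vectors). The diophantine exponent $\omega(B)$ of a real matrix $B$ with $m$ columns is the supremum (possibly $\infty$) of all $\omega\in\mathbb{R}$ such that $\|B\bm{q}^{\mathrm T}\|<|\bm{q}|^{-\omega}$ holds for infinitely many $\bm{q}\in\mathbb{Z}^m$. For $\psi:\mathbb{N}\to\mathbb{R}_{\ge0}$ let $\mathcal{S}_n(\psi)=\{\bm{y}\in\mathbb{R}^n:\|q\bm{y}\|<\psi(q)\text{ for infinitely many }q\in\mathbb{N}\}$. A submanifold $\mathcal{M}$ of $\mathbb{R}^n$ is of strong Khintchine type for convergence if for every (not necessarily monotonic) $\psi:\mathbb{N}\to\mathbb{R}_{\ge0}$ with $\sum_q\psi(q)^n<\infty$ the set $\mathcal{S}_n(\psi)\cap\mathcal{M}$ is null with respect to the induced Lebesgue measure on $\mathcal{M}$. *)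

theory Defs
  imports "HOL-Analysis.Analysis"
begin

definition int_vectors :: "(real ^ 'n) set" where
  "int_vectors = {z. \<forall>i. z $ i \<in> \<int>}"

definition dist_int :: "real ^ 'n \<Rightarrow> real" where
  "dist_int y = (INF z\<in>int_vectors. infnorm (y - z))"

text \<open>The zero vector contributes at most one \<^term>\<open>q\<close>, so the value of
  \<^term>\<open>0 powr (- w)\<close> is irrelevant.\<close>

definition diophantine_exponent :: "real ^ 'm ^ 'k \<Rightarrow> ereal" where
  "diophantine_exponent B =
     (SUP w\<in>{w. infinite {q\<in>int_vectors. dist_int (B *v q) < infnorm q powr (- w)}}. ereal w)"

definition approximable :: "(nat \<Rightarrow> real) \<Rightarrow> (real ^ 'n) set" where
  "approximable \<psi> = {y. infinite {q::nat. q \<ge> 1 \<and> dist_int (real q *\<^sub>R y) < \<psi> q}}"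

text \<open>A regular \<open>C\<^sup>1\<close> parametrization of a relatively open part of \<open>M\<close> by an open
  set \<open>U\<close>; \<open>D u\<close> is the Jacobian matrix of \<open>\<phi>\<close> at \<open>u\<close>.\<close>

definition local_param ::
  "(real ^ 'n) set \<Rightarrow> (real ^ 'd) set \<Rightarrow> (real ^ 'd \<Rightarrow> real ^ 'n) \<Rightarrow> (real ^ 'd \<Rightarrow> real ^ 'd ^ 'n) \<Rightarrow> bool"
where
  "local_param M U \<phi> D \<longleftrightarrow>
     open U \<and> openin (top_of_set M) (\<phi> ` U) \<and>
     (\<exists>\<theta>. homeomorphism U (\<phi> ` U) \<phi> \<theta>) \<and>
     (\<forall>u\<in>U. (\<phi> has_derivative (\<lambda>h. D u *v h)) (at u)) \<and>
     continuous_on U D \<and>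
     (\<forall>u\<in>U. inj (\<lambda>h. D u *v h))"

text \<open>The type argument carries the dimension \<open>CARD('d)\<close> of the submanifold.\<close>

definition submanifold :: "'d::finite itself \<Rightarrow> (real ^ 'n) set \<Rightarrow> bool" where
  "submanifold T M \<longleftrightarrow>
     (\<forall>p\<in>M. \<exists>(U :: (real ^ 'd) set) \<phi> D. local_param M U \<phi> D \<and> p \<in> \<phi> ` U)"

text \<open>The Riemannian volume of the piece \<open>\<phi> ` E\<close>: the integral over \<open>E\<close> of the square
  root of the Gram determinant of the Jacobian matrix.\<close>

definition param_volume :: "(real ^ 'd) set \<Rightarrow> (real ^ 'd \<Rightarrow> real ^ 'd ^ 'n) \<Rightarrow> ennreal" where
  "param_volume E D =
     (\<integral>\<^sup>+u\<in>E. ennreal (sqrt (det (transpose (D u) ** D u))) \<partial>lebesgue)"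

text \<open>The induced Lebesgue measure on \<open>M\<close>, as an outer measure on all subsets \<open>S\<close> of \<open>M\<close>:
  the infimum of the total volumes of countable covers by parametrized pieces. For a
  submanifold, which is second countable, it extends the Riemannian volume measure of
  the metric induced from the ambient Euclidean space, and its null sets are the null sets
  of the completed volume measure. Pieces may be empty, so finite covers are included.\<close>

definition induced_lebesgue :: "'d::finite itself \<Rightarrow> (real ^ 'n) set \<Rightarrow> (real ^ 'n) set \<Rightarrow> ennreal" where
  "induced_lebesgue T M S =
     Inf {(\<Sum>i. param_volume (E i) (D i)) |
            (U :: nat \<Rightarrow> (real ^ 'd) set) \<phi> D E.
            (\<forall>i. local_param M (U i) (\<phi> i) (D i) \<and> E i \<in> sets lebesgue \<and> E i \<subseteq> U i) \<and>
            S \<subseteq> (\<Union>i. \<phi> i ` E i)}"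

text \<open>The values \<open>\<psi> 0\<close> play no role: \<^const>\<open>approximable\<close> only refers to positive \<open>q\<close>.\<close>

definition strong_khintchine_convergence :: "'d::finite itself \<Rightarrow> (real ^ 'n) set \<Rightarrow> bool" where
  "strong_khintchine_convergence T M \<longleftrightarrow>
     submanifold T M \<and>
     (\<forall>\<psi>. (\<forall>q. 0 \<le> \<psi> q) \<and> summable (\<lambda>q. \<psi> q ^ CARD('n)) \<longrightarrow>
          induced_lebesgue T M (approximable \<psi> \<inter> M) = 0)"

text \<open>Rows of a matrix with \<open>d + 1\<close> rows are indexed by \<^typ>\<open>'d option\<close>, with
  \<^const>\<open>None\<close> the top row; \<open>\<real>\<^sup>n\<close> with \<open>n = d + m\<close> is indexed by \<^typ>\<open>'d + 'm\<close>.\<close>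

definition add_top_row :: "real ^ 'm \<Rightarrow> real ^ 'm ^ 'd \<Rightarrow> real ^ 'm ^ ('d::finite option)" where
  "add_top_row b B = (\<chi> i. case i of None \<Rightarrow> b | Some j \<Rightarrow> B $ j)"

definition tilde :: "real ^ 'd \<Rightarrow> real ^ ('d::finite option)" where
  "tilde x = (\<chi> i. case i of None \<Rightarrow> 1 | Some j \<Rightarrow> x $ j)"

definition join_vec :: "real ^ 'd \<Rightarrow> real ^ 'm \<Rightarrow> real ^ ('d::finite + 'm::finite)" where
  "join_vec x y = (\<chi> k. case k of Inl i \<Rightarrow> x $ i | Inr j \<Rightarrow> y $ j)"

definition affine_graph :: "real ^ 'm ^ ('d option) \<Rightarrow> (real ^ ('d::finite + 'm::finite)) set" where
  "affine_graph A = {join_vec x (tilde x v* A) | x. True}"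

end

theory Submission
  imports Defs "HOL-Probability.Probability" "HOL-Real_Asymp.Real_Asymp"
begin

text \<open>
  The affine space is the graph of \<open>x \<mapsto> \<beta> + x A'\<close>, parametrized by
  \<open>y(x) = (x, \<beta> + x A')\<close>. By the Borel--Cantelli lemma it suffices to give \<open>\<real>\<^sup>d\<close> a
  probability measure equivalent to Lebesgue measure for which the sets
  \<open>{x. \<parallel>q y(x)\<parallel> < \<psi>(q)}\<close> have summable measure. The measure used is the standard Gaussian,
  because its Fourier transform \<open>exp (- \<bar>v\<bar>\<^sup>2 / 2)\<close> is explicit and decays faster than any power.

  Nearness to integer points is detected by an exponential sum. If \<open>\<parallel>q y\<parallel> < \<delta>\<close> and
  \<open>N \<le> 1 / (6 n \<delta>)\<close>, then for every \<open>k \<in> {0..<N}\<^sup>n\<close> the number \<open>q k \<bullet> y\<close> lies within \<open>1/6\<close>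
  of an integer, so \<open>\<Sum>\<^sub>k e(q k \<bullet> y)\<close>, where \<open>e(t) = exp (2 \<pi> \<i> t)\<close>, has modulus at least
  \<open>N\<^sup>n / 2\<close> (\<open>exp_sum_ge\<close>). The mean square of the sum has \<open>N\<^sup>n\<close> diagonal terms
  equal to \<open>1\<close>; the term for \<open>h = k - l \<noteq> 0\<close> is the
  Gaussian Fourier transform at \<open>2 \<pi> q (h\<^sub>1 + A' h\<^sub>2)\<close>, where \<open>h = (h\<^sub>1, h\<^sub>2)\<close>, up to a constant
  phase that contains \<open>\<beta>\<close>. Chebyshev's inequality (\<open>mean_square_bound\<close>) therefore bounds the
  measure by \<open>4 N\<^sup>-\<^sup>n\<close>, which is of order \<open>\<delta>\<^sup>n\<close>, plus a multiple of the largest off-diagonal term.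

  The exponent enters only in the off-diagonal terms. As \<open>\<omega>(A') < n\<close>, there are \<open>w\<close> with
  \<open>0 < w < n\<close> and \<open>c > 0\<close> such that \<open>\<parallel>A' j\<parallel> \<ge> c \<bar>j\<bar> powr (- w)\<close> for all integer vectors \<open>j \<noteq> 0\<close>
  (\<open>exponent_less_imp_dist_int_ge\<close>), whence \<open>\<bar>h\<^sub>1 + A' h\<^sub>2\<bar> \<ge> c N powr (- w)\<close>
  (\<open>norm_frequency_ge\<close>). Fix \<open>\<kappa>\<close> with \<open>1/n < \<kappa> < 1/w\<close> and replace \<open>\<psi>(q)\<close> by the larger
  \<open>\<delta>(q) = max (\<psi>(q)) (q powr (- \<kappa>))\<close>: the \<open>n\<close>-th powers remain summable because \<open>\<kappa> n > 1\<close>, and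
  now \<open>N \<le> q powr \<kappa>\<close>, so every off-diagonal frequency is at least of order \<open>q powr (1 - w \<kappa>)\<close>,
  a positive power of \<open>q\<close>. The off-diagonal terms are then superpolynomially small in \<open>q\<close>, and
  both parts of the bound are summable.
\<close>

section \<open>The standard Gaussian measure\<close>

text \<open>Fubini's theorem along the coordinate axes: the Bochner-integral counterpart of
  \<open>nn_integral_lborel_prod\<close>, needed for the complex-valued characters below.\<close>

lemma integral_lborel_prod:
  fixes f :: "'a::euclidean_space \<Rightarrow> real \<Rightarrow> 'b::{real_normed_field,banach,second_countable_topology}"
  assumes "\<And>b. b \<in> Basis \<Longrightarrow> integrable lborel (f b)"
  shows "(\<integral>x. (\<Prod>b\<in>Basis. f b (x \<bullet> b)) \<partial>lborel) = (\<Prod>b\<in>Basis. \<integral>t. f b t \<partial>lborel)"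
proof -
  interpret product_sigma_finite "\<lambda>_::'a. lborel :: real measure" ..
  have [measurable]: "f b \<in> borel_measurable borel" if "b \<in> Basis" for b
    using borel_measurable_integrable[OF assms[OF that]] by simp
  have eq: "(\<Prod>b\<in>Basis. f b ((\<Sum>b\<in>Basis. g b *\<^sub>R b) \<bullet> b)) = (\<Prod>b\<in>Basis. f b (g b))" for g
    by (intro prod.cong refl) simp
  show "(\<integral>x. (\<Prod>b\<in>Basis. f b (x \<bullet> b)) \<partial>lborel) = (\<Prod>b\<in>Basis. \<integral>t. f b t \<partial>lborel)"
    using product_integral_prod[OF finite_Basis assms]
    by (subst lborel_eq) (simp add: integral_distr eq)
qed

definition gauss_density :: "'a::euclidean_space \<Rightarrow> real" where
  "gauss_density x = (\<Prod>b\<in>Basis. std_normal_density (x \<bullet> b))"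

definition gauss :: "'a::euclidean_space measure" where
  "gauss = density lborel (\<lambda>x. ennreal (gauss_density x))"

lemma gauss_density_pos: "0 < gauss_density x"
  unfolding gauss_density_def by (intro prod_pos) (auto intro: normal_density_pos)

lemma gauss_density_measurable [measurable]: "gauss_density \<in> borel_measurable borel"
  unfolding gauss_density_def by measurable

lemma sets_gauss [simp, measurable_cong]: "sets gauss = sets borel"
  and space_gauss [simp]: "space gauss = UNIV"
  by (simp_all add: gauss_def)

lemma AE_gauss_iff: "(AE x in gauss. P x) \<longleftrightarrow> (AE x in lborel. P x)"
  unfolding gauss_def by (subst AE_density) (auto simp: gauss_density_pos)

lemma std_normal_iexp:
  "integrable lborel (\<lambda>t. of_real (std_normal_density t) * iexp (s * t))"
  "(\<integral>t. of_real (std_normal_density t) * iexp (s * t) \<partial>lborel) = complex_of_real (exp (- s\<^sup>2 / 2))"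
proof -
  have "integrable std_normal_distribution (\<lambda>t. iexp (s * t))"
    using prob_space_normal_density[of 1 0]
    by (intro finite_measure.integrable_const_bound[where B=1]) (auto simp: prob_space_def)
  then show "integrable lborel (\<lambda>t. of_real (std_normal_density t) * iexp (s * t))"
    by (subst (asm) integrable_density) (auto simp: scaleR_conv_of_real)
  have "char std_normal_distribution s = (\<integral>t. of_real (std_normal_density t) * iexp (s * t) \<partial>lborel)"
    unfolding char_def by (subst integral_density) (auto simp: scaleR_conv_of_real)
  then show "(\<integral>t. of_real (std_normal_density t) * iexp (s * t) \<partial>lborel) = complex_of_real (exp (- s\<^sup>2 / 2))"
    by (simp add: char_std_normal_distribution)
qed

text \<open>The density and the character both factor over the coordinates, so the one-dimensional
  characteristic function of the normal distribution suffices.\<close>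

lemma gauss_integral_iexp:
  fixes v :: "'a::euclidean_space"
  shows "(\<integral>x. iexp (v \<bullet> x) \<partial>gauss) = complex_of_real (exp (- (norm v)\<^sup>2 / 2))"
proof -
  have eq: "gauss_density x *\<^sub>R iexp (v \<bullet> x) =
      (\<Prod>b\<in>Basis. of_real (std_normal_density (x \<bullet> b)) * iexp ((v \<bullet> b) * (x \<bullet> b)))" for x
  proof -
    have "iexp (v \<bullet> x) = (\<Prod>b\<in>Basis. iexp ((v \<bullet> b) * (x \<bullet> b)))"
      by (subst euclidean_inner) (simp add: exp_sum sum_distrib_left)
    then show ?thesis
      by (simp add: gauss_density_def scaleR_conv_of_real prod.distrib)
  qed
  have "(\<integral>x. iexp (v \<bullet> x) \<partial>gauss) = (\<integral>x. gauss_density x *\<^sub>R iexp (v \<bullet> x) \<partial>lborel)"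
    unfolding gauss_def by (subst integral_density) (auto simp: gauss_density_pos less_imp_le)
  also have "\<dots> = (\<Prod>b\<in>Basis. complex_of_real (exp (- (v \<bullet> b)\<^sup>2 / 2)))"
    unfolding eq
    by (subst integral_lborel_prod[of "\<lambda>b t. of_real (std_normal_density t) * iexp ((v \<bullet> b) * t)"])
      (simp_all only: std_normal_iexp)
  also have "\<dots> = complex_of_real (exp (\<Sum>b\<in>Basis. - (v \<bullet> b)\<^sup>2 / 2))"
    by (simp add: exp_sum)
  also have "(\<Sum>b\<in>Basis. - (v \<bullet> b)\<^sup>2 / 2) = - (norm v)\<^sup>2 / 2"
    unfolding power2_norm_eq_inner euclidean_inner[of v v]
    by (simp add: sum_negf sum_divide_distrib[symmetric] power2_eq_square)
  finally show ?thesis .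
qed

lemma prob_space_gauss: "prob_space (gauss :: 'a::euclidean_space measure)"
proof
  have "emeasure gauss (space (gauss :: 'a measure)) = (\<integral>\<^sup>+x. (\<Prod>b\<in>Basis. ennreal (std_normal_density (x \<bullet> b))) \<partial>(lborel :: 'a measure))"
    by (simp add: gauss_def emeasure_density gauss_density_def prod_ennreal)
  also have "\<dots> = (\<Prod>b\<in>(Basis::'a set). \<integral>\<^sup>+t. ennreal (std_normal_density t) \<partial>lborel)"
    by (subst nn_integral_lborel_prod[of "\<lambda>_ t. ennreal (std_normal_density t)"]) auto
  also have "(\<integral>\<^sup>+t. ennreal (std_normal_density t) \<partial>lborel) = 1"
    using prob_space.emeasure_space_1[OF prob_space_normal_density[of 1 0]]
    by (simp add: emeasure_density)
  finally show "emeasure gauss (space (gauss :: 'a measure)) = 1" by simp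
qed

section \<open>Mean squares of exponential sums\<close>

text \<open>Chebyshev's inequality. The expectation of \<open>\<bar>\<Sum>\<^sub>k iexp (\<theta> k)\<bar>\<^sup>2\<close> is a double sum over \<open>S\<close> in which
  each diagonal term is \<open>1\<close>, so nearly orthogonal phases rarely produce a sum of the
  order of \<open>card S\<close>.\<close>

lemma (in prob_space) mean_square_bound:
  fixes \<theta> :: "'k \<Rightarrow> 'a \<Rightarrow> real"
  assumes S: "finite S" "S \<noteq> {}"
    and [measurable]: "\<And>k. \<theta> k \<in> borel_measurable M"
    and off: "\<And>k l. k \<in> S \<Longrightarrow> l \<in> S \<Longrightarrow> k \<noteq> l \<Longrightarrow> norm (\<integral>x. iexp (\<theta> k x - \<theta> l x) \<partial>M) \<le> e"
    and e: "0 \<le> e"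
  shows "measure M {x\<in>space M. card S / 2 \<le> norm (\<Sum>k\<in>S. iexp (\<theta> k x))} \<le> 4 / card S + 4 * e"
proof -
  define T where "T x = (\<Sum>k\<in>S. iexp (\<theta> k x))" for x
  have [measurable]: "T \<in> borel_measurable M" unfolding T_def by measurable
  have int: "integrable M (\<lambda>x. iexp (\<theta> k x - \<theta> l x))" for k l
    by (intro integrable_const_bound[where B=1]) auto
  have sq: "complex_of_real ((norm (T x))\<^sup>2) = (\<Sum>k\<in>S. \<Sum>l\<in>S. iexp (\<theta> k x - \<theta> l x))" for x
  proof -
    have "complex_of_real ((norm (T x))\<^sup>2) = T x * cnj (T x)"
      by (metis complex_norm_square)
    also have "\<dots> = (\<Sum>k\<in>S. \<Sum>l\<in>S. iexp (\<theta> k x) * iexp (- \<theta> l x))"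
      by (simp add: T_def sum_product exp_cnj)
    also have "\<dots> = (\<Sum>k\<in>S. \<Sum>l\<in>S. iexp (\<theta> k x - \<theta> l x))"
      by (simp add: exp_add[symmetric] right_diff_distrib)
    finally show ?thesis .
  qed
  have iT: "integrable M (\<lambda>x. (norm (T x))\<^sup>2)"
  proof -
    have "integrable M (\<lambda>x. complex_of_real ((norm (T x))\<^sup>2))"
      unfolding sq by (intro Bochner_Integration.integrable_sum int)
    then show ?thesis by (subst (asm) complex_of_real_integrable_eq)
  qed
  have c0: "0 < real (card S)" using S by (simp add: card_gt_0_iff)
  have "(\<integral>x. (norm (T x))\<^sup>2 \<partial>M) = norm (\<integral>x. complex_of_real ((norm (T x))\<^sup>2) \<partial>M)"
    by (subst integral_complex_of_real) (simp del: of_real_power)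
  also have "\<dots> = norm (\<Sum>k\<in>S. \<Sum>l\<in>S. \<integral>x. iexp (\<theta> k x - \<theta> l x) \<partial>M)"
    unfolding sq by (simp add: Bochner_Integration.integral_sum int del: of_real_diff)
  also have "\<dots> \<le> (\<Sum>k\<in>S. \<Sum>l\<in>S. (if k = l then 1 else 0) + e)"
  proof (intro order.trans[OF norm_sum] sum_mono)
    fix k l assume "k \<in> S" "l \<in> S"
    then show "norm (\<integral>x. iexp (\<theta> k x - \<theta> l x) \<partial>M) \<le> (if k = l then 1 else 0) + e"
      using off[of k l] e by (auto simp: prob_space)
  qed
  also have "\<dots> = card S + (card S)\<^sup>2 * e"
    using S by (simp add: sum.distrib power2_eq_square algebra_simps)
  finally have mom: "(\<integral>x. (norm (T x))\<^sup>2 \<partial>M) \<le> card S + (card S)\<^sup>2 * e" .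
  have "{x\<in>space M. card S / 2 \<le> norm (T x)} = {x\<in>space M. (card S / 2)\<^sup>2 \<le> (norm (T x))\<^sup>2}"
    by (simp only: power_mono_iff norm_ge_zero divide_nonneg_nonneg of_nat_0_le_iff zero_le_numeral pos2)
  then have "measure M {x\<in>space M. card S / 2 \<le> norm (T x)} \<le> (\<integral>x. (norm (T x))\<^sup>2 \<partial>M) / (card S / 2)\<^sup>2"
    using integral_Markov_inequality_measure[OF iT, of "{}" "(card S / 2)\<^sup>2"] c0 by simp
  also have "\<dots> \<le> (card S + (card S)\<^sup>2 * e) / (card S / 2)\<^sup>2"
    using mom by (intro divide_right_mono) auto
  also have "\<dots> = 4 / card S + 4 * e"
    using c0 by (simp add: field_simps power2_eq_square)
  finally show ?thesis unfolding T_def .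
qed

section \<open>Integer vectors and the exponential sum over a box\<close>

lemma int_vectors_0 [simp]: "0 \<in> int_vectors"
  and int_vectors_scale: "z \<in> int_vectors \<Longrightarrow> real k *\<^sub>R z \<in> int_vectors"
  and int_vectors_uminus: "z \<in> int_vectors \<Longrightarrow> - z \<in> int_vectors"
  by (auto simp: int_vectors_def)

lemma infnorm_int_vector_ge_1:
  assumes "z \<in> int_vectors" "z \<noteq> 0"
  shows "1 \<le> infnorm z"
proof -
  obtain i where "z $ i \<noteq> 0" using assms(2) by (auto simp: vec_eq_iff)
  moreover obtain a where "z $ i = of_int a" using assms(1) by (auto simp: int_vectors_def elim: Ints_cases)
  ultimately have "1 \<le> \<bar>z $ i\<bar>" by simp
  then show ?thesis using component_le_infnorm_cart order_trans by blast
qed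

lemma bdd_below_infnorm: "bdd_below ((\<lambda>z. infnorm (y - z)) ` Z)"
  by (intro bdd_belowI[of _ 0]) (auto simp: infnorm_pos_le)

lemma dist_int_le: "z \<in> int_vectors \<Longrightarrow> dist_int y \<le> infnorm (y - z)"
  unfolding dist_int_def by (intro cINF_lower bdd_below_infnorm)

lemma dist_int_nonneg: "0 \<le> dist_int y"
  unfolding dist_int_def
  by (rule cINF_greatest) (use int_vectors_0 in \<open>blast intro: infnorm_pos_le\<close>)+

lemma dist_int_less_obtains:
  assumes "dist_int y < r"
  obtains z where "z \<in> int_vectors" "infnorm (y - z) < r"
proof -
  have "\<exists>z\<in>int_vectors. infnorm (y - z) < r"
    using assms unfolding dist_int_def
    by (subst (asm) cINF_less_iff[OF _ bdd_below_infnorm]) (use int_vectors_0 in blast)+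
  then show thesis using that by blast
qed

text \<open>Multiplication by \<open>k\<close> maps each integer vector that competes in the infimum for \<open>y\<close> to one that
  competes for \<open>real k *\<^sub>R y\<close>.\<close>

lemma dist_int_scale: "dist_int (real k *\<^sub>R y) \<le> real k * dist_int y"
proof (cases "k = 0")
  case True
  then show ?thesis using dist_int_le[OF int_vectors_0, of 0] by (simp add: infnorm_0)
next
  case False
  have "dist_int (real k *\<^sub>R y) / real k \<le> dist_int y"
    unfolding dist_int_def[of y]
  proof (rule cINF_greatest)
    fix z :: "real ^ 'a" assume "z \<in> int_vectors"
    then have "dist_int (real k *\<^sub>R y) \<le> infnorm (real k *\<^sub>R (y - z))"
      unfolding scaleR_right_diff_distrib by (intro dist_int_le int_vectors_scale)
    then show "dist_int (real k *\<^sub>R y) / real k \<le> infnorm (y - z)"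
      using False by (simp only: infnorm_mul) (simp add: field_simps)
  qed (use int_vectors_0 in blast)
  then show ?thesis using False by (simp add: field_simps)
qed

definition grid :: "nat \<Rightarrow> (real ^ 'n) set" where
  "grid N = (\<lambda>f. \<chi> i. real (f i)) ` (UNIV \<rightarrow>\<^sub>E {..<N})"

lemma finite_grid: "finite (grid N :: (real ^ 'n) set)"
  and card_grid: "card (grid N :: (real ^ 'n) set) = N ^ CARD('n::finite)"
proof -
  have "inj_on (\<lambda>f. (\<chi> i. real (f i)) :: real ^ 'n) (UNIV \<rightarrow>\<^sub>E {..<N})"
    by (auto simp: inj_on_def vec_eq_iff)
  then show "finite (grid N :: (real ^ 'n) set)" "card (grid N :: (real ^ 'n) set) = N ^ CARD('n)"
    by (simp_all add: grid_def card_image finite_PiE card_PiE)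
qed

lemma grid_nth: "k \<in> grid N \<Longrightarrow> \<exists>a<N. k $ i = real a"
  by (auto simp: grid_def PiE_def Pi_def)

lemma grid_diff:
  assumes "k \<in> grid N" "l \<in> grid N"
  shows "k - l \<in> int_vectors" "infnorm (k - l) \<le> real N"
proof -
  have *: "(k - l) $ i \<in> \<int> \<and> \<bar>(k - l) $ i\<bar> \<le> real N" for i
  proof -
    obtain a b where "a < N" "b < N" "k $ i = real a" "l $ i = real b" using grid_nth assms by metis
    then show ?thesis by auto
  qed
  then show "k - l \<in> int_vectors" unfolding int_vectors_def by blast
  show "infnorm (k - l) \<le> real N"
    unfolding infnorm_cart using * by (intro cSup_least) auto
qed

text \<open>Modulo \<open>2 \<pi>\<close> no phase changes when \<open>y\<close> is replaced by its difference \<open>y - z\<close> to a nearby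
  integer vector \<open>z\<close>; that difference is small enough to keep all phases within \<open>\<pi> / 3\<close> of \<open>0\<close>,
  where the cosine is at least \<open>1 / 2\<close>, so no cancellation occurs.\<close>

lemma exp_sum_ge:
  fixes y :: "real ^ 'n::finite"
  assumes y: "dist_int y < r" and r: "real CARD('n) * real N * r \<le> 1 / 6"
  shows "real (N ^ CARD('n)) / 2 \<le> norm (\<Sum>k\<in>grid N. iexp (2 * pi * (k \<bullet> y)))"
proof -
  obtain z where z: "z \<in> int_vectors" "infnorm (y - z) < r" using dist_int_less_obtains[OF y] .
  have term_ge: "1 / 2 \<le> Re (iexp (2 * pi * (k \<bullet> y)))" if k: "k \<in> grid N" for k
  proof -
    have "k \<bullet> z \<in> \<int>"
      unfolding inner_vec_def
    proof (rule Ints_sum)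
      fix i
      obtain a where "k $ i = real a" using grid_nth[OF k] by blast
      then show "k $ i \<bullet> z $ i \<in> \<int>" using z(1) by (auto simp: int_vectors_def)
    qed
    then obtain a where a: "k \<bullet> z = of_int a" by (auto elim: Ints_cases)
    have "\<bar>k \<bullet> (y - z)\<bar> \<le> (\<Sum>i\<in>UNIV. \<bar>k $ i\<bar> * \<bar>(y - z) $ i\<bar>)"
      unfolding inner_vec_def by (simp add: abs_mult[symmetric] del: vector_minus_component)
    also have "\<dots> \<le> (\<Sum>i\<in>(UNIV::'n set). real N * r)"
    proof (intro sum_mono mult_mono)
      fix i
      show "\<bar>k $ i\<bar> \<le> real N" using grid_nth[OF k, of i] by auto
      show "\<bar>(y - z) $ i\<bar> \<le> r" using component_le_infnorm_cart[of "y - z" i] z(2) by linarith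
    qed auto
    also have "\<dots> \<le> 1 / 6" using r by (simp add: mult_ac)
    finally have small: "\<bar>k \<bullet> (y - z)\<bar> \<le> 1 / 6" .
    have "1 / 2 = cos (pi / 3)" by (simp add: cos_60)
    also have "\<dots> \<le> cos \<bar>2 * pi * (k \<bullet> (y - z))\<bar>"
    proof (rule cos_monotone_0_pi_le)
      have "2 * pi * \<bar>k \<bullet> (y - z)\<bar> \<le> 2 * pi * (1 / 6)"
        using small by (intro mult_left_mono) auto
      then show "\<bar>2 * pi * (k \<bullet> (y - z))\<bar> \<le> pi / 3" by (simp add: abs_mult)
    qed auto
    also have "\<dots> = cos (2 * pi * (k \<bullet> (y - z)) + 2 * pi * of_int a)"
      by (simp add: cos_add)
    also have "2 * pi * (k \<bullet> (y - z)) + 2 * pi * of_int a = 2 * pi * (k \<bullet> y)"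
      unfolding inner_diff_right a[symmetric] by (simp add: algebra_simps)
    also have "cos (2 * pi * (k \<bullet> y)) = Re (iexp (2 * pi * (k \<bullet> y)))"
      by (simp add: Re_exp)
    finally show ?thesis .
  qed
  have "real (N ^ CARD('n)) / 2 = (\<Sum>k\<in>(grid N :: (real ^ 'n) set). 1 / 2)"
    by (simp add: card_grid)
  also have "\<dots> \<le> (\<Sum>k\<in>grid N. Re (iexp (2 * pi * (k \<bullet> y))))"
    using term_ge by (intro sum_mono) auto
  also have "\<dots> = Re (\<Sum>k\<in>grid N. iexp (2 * pi * (k \<bullet> y)))"
    by (simp only: Re_sum)
  also have "\<dots> \<le> norm (\<Sum>k\<in>grid N. iexp (2 * pi * (k \<bullet> y)))"
    by (rule complex_Re_le_cmod)
  finally show ?thesis .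
qed

section \<open>A lower bound from the Diophantine exponent\<close>

text \<open>If \<open>B j\<close> had distance \<open>0\<close> to the integer vectors, so would all its multiples, and these would be
  infinitely many solutions.\<close>

lemma dist_int_pos_of_exponent_finite:
  fixes B :: "real ^ 'm::finite ^ 'k::finite"
  assumes fin: "finite {q\<in>int_vectors. dist_int (B *v q) < infnorm q powr (- w)}"
    and j: "j \<in> int_vectors" "j \<noteq> 0"
  shows "0 < dist_int (B *v j)"
proof (rule ccontr)
  assume "\<not> 0 < dist_int (B *v j)"
  then have 0: "dist_int (B *v j) = 0" using dist_int_nonneg[of "B *v j"] by simp
  have "(\<lambda>k. real k *\<^sub>R j) ` {1..} \<subseteq> {q\<in>int_vectors. dist_int (B *v q) < infnorm q powr (- w)}"
  proof clarify
    fix k :: nat assume k: "1 \<le> k"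
    have "dist_int (B *v (real k *\<^sub>R j)) \<le> 0"
      using dist_int_scale[of k "B *v j"] 0 by (simp add: matrix_vector_mult_scaleR)
    also have "0 < infnorm (real k *\<^sub>R j) powr (- w)"
      using k j by (simp add: infnorm_eq_0)
    finally show "real k *\<^sub>R j \<in> int_vectors \<and> dist_int (B *v (real k *\<^sub>R j)) < infnorm (real k *\<^sub>R j) powr (- w)"
      using int_vectors_scale j by blast
  qed
  moreover have "infinite ((\<lambda>k. real k *\<^sub>R j) ` {1..})"
    using j(2) by (subst finite_image_iff) (auto simp: inj_on_def infinite_Ici)
  ultimately show False using fin finite_subset by blast
qed

text \<open>A number \<open>w\<close> above the exponent leaves only finitely many exceptional vectors, at each of which
  the distance is positive; the constant \<open>c\<close> absorbs them.\<close>

lemma exponent_less_imp_dist_int_ge: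
  fixes B :: "real ^ 'm::finite ^ 'k::finite"
  assumes "diophantine_exponent B < ereal s" and "0 < s"
  obtains w c where "0 < w" "w < s" "0 < c" "c \<le> 1"
    "\<And>j. j \<in> int_vectors \<Longrightarrow> j \<noteq> 0 \<Longrightarrow> c * infnorm j powr (- w) \<le> dist_int (B *v j)"
proof -
  \<comment> \<open>The exponent may be negative; a positive \<open>w\<close> makes \<open>x powr (- w)\<close> antitone later on.\<close>
  have "max (diophantine_exponent B) 0 < ereal s" using assms by simp
  then obtain w where "max (diophantine_exponent B) 0 < ereal w" "ereal w < ereal s"
    using ereal_dense2 by blast
  then have w: "diophantine_exponent B < ereal w" "0 < w" "w < s" by simp_all
  define F where "F = {q\<in>int_vectors. dist_int (B *v q) < infnorm q powr (- w)}"
  have fin: "finite F"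
  proof (rule ccontr)
    assume "infinite F"
    then have "ereal w \<le> diophantine_exponent B"
      unfolding diophantine_exponent_def F_def by (intro SUP_upper) auto
    then show False using w(1) by simp
  qed
  define g where "g j = dist_int (B *v j) * infnorm j powr w" for j
  define c where "c = Min (insert 1 (g ` (F - {0})))"
  have gpos: "0 < g j" if "j \<in> int_vectors" "j \<noteq> 0" for j
    using dist_int_pos_of_exponent_finite[OF fin[unfolded F_def] that] that
    by (auto simp: g_def infnorm_eq_0)
  show thesis
  proof (rule that[OF w(2,3)])
    show "0 < c" unfolding c_def using fin gpos by (subst Min_gr_iff) (auto simp: F_def)
    show "c \<le> 1" unfolding c_def using fin by (intro Min_le) auto
    fix j :: "real ^ 'm" assume j: "j \<in> int_vectors" "j \<noteq> 0"
    have pos: "0 < infnorm j" using j by (simp add: infnorm_pos_lt)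
    have "c \<le> g j"
    proof (cases "j \<in> F")
      case True
      then show ?thesis unfolding c_def using fin j by (intro Min_le) auto
    next
      case False
      then have "infnorm j powr (- w) * infnorm j powr w \<le> g j"
        unfolding g_def using j by (intro mult_right_mono) (auto simp: F_def)
      then show ?thesis using \<open>c \<le> 1\<close> pos by (simp add: powr_add[symmetric])
    qed
    then show "c * infnorm j powr (- w) \<le> dist_int (B *v j)"
      using pos by (simp add: g_def powr_minus field_simps)
  qed
qed

section \<open>The affine space as a graph\<close>

definition left_part :: "real ^ ('d::finite + 'm::finite) \<Rightarrow> real ^ 'd" where
  "left_part h = (\<chi> i. h $ Inl i)"

definition right_part :: "real ^ ('d::finite + 'm::finite) \<Rightarrow> real ^ 'm" where
  "right_part h = (\<chi> j. h $ Inr j)"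

lemma left_part_join_vec [simp]: "left_part (join_vec x y) = x"
  by (simp add: left_part_def join_vec_def vec_eq_iff)

lemma inner_join_vec: "h \<bullet> join_vec x y = left_part h \<bullet> x + right_part h \<bullet> y"
  by (simp add: inner_vec_def UNIV_Plus_UNIV[symmetric] sum.Plus left_part_def right_part_def join_vec_def
      del: UNIV_Plus_UNIV)

text \<open>The top row of the matrix meets the coordinate \<open>1\<close> of \<open>tilde x\<close> and becomes the translation part.\<close>

lemma tilde_mult_add_top_row: "tilde x v* add_top_row b B = b + x v* B"
  by (simp add: vector_matrix_mult_def tilde_def add_top_row_def vec_eq_iff UNIV_option_conv
      sum.reindex mult.commute)

definition graph_param :: "real ^ 'm \<Rightarrow> real ^ 'm ^ 'd \<Rightarrow> real ^ 'd \<Rightarrow> real ^ ('d::finite + 'm::finite)" where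
  "graph_param b B x = join_vec x (b + x v* B)"

lemma affine_graph_eq: "affine_graph (add_top_row b B) = range (graph_param b B)"
  by (auto simp: affine_graph_def tilde_mult_add_top_row graph_param_def)

text \<open>As a function of \<open>x\<close>, a character of \<open>\<real>\<^sup>n\<close> restricted to the graph is a character of \<open>\<real>\<^sup>d\<close> whose
  frequency is independent of \<open>b\<close>; the translation \<open>b\<close> contributes a constant phase.\<close>

lemma inner_graph_param:
  "h \<bullet> graph_param b B x = (left_part h + B *v right_part h) \<bullet> x + right_part h \<bullet> b"
proof -
  have "right_part h \<bullet> (x v* B) = (B *v right_part h) \<bullet> x"
    by (metis dot_lmul_matrix inner_commute)
  then show ?thesis
    by (simp add: graph_param_def inner_join_vec inner_add_left inner_add_right)
qed

text \<open>If \<open>right_part h \<noteq> 0\<close>, the frequency is the difference of \<open>B *v right_part h\<close> and an integer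
  vector, which the Diophantine hypothesis bounds below. Otherwise it is a nonzero integer vector.\<close>

lemma norm_frequency_ge:
  fixes B :: "real ^ 'm::finite ^ 'd::finite"
  assumes B: "\<And>j. j \<in> int_vectors \<Longrightarrow> j \<noteq> 0 \<Longrightarrow> c * infnorm j powr (- w) \<le> dist_int (B *v j)"
    and c: "0 < c" "c \<le> 1" and w: "0 < w"
    and h: "h \<in> int_vectors" "h \<noteq> 0" "infnorm h \<le> real N"
  shows "c * real N powr (- w) \<le> norm (left_part h + B *v right_part h)"
proof -
  have int: "left_part h \<in> int_vectors" "right_part h \<in> int_vectors"
    using h(1) by (auto simp: int_vectors_def left_part_def right_part_def)
  have N: "1 \<le> real N" using infnorm_int_vector_ge_1[OF h(1,2)] h(3) by simp
  have "c * real N powr (- w) \<le> infnorm (left_part h + B *v right_part h)"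
  proof (cases "right_part h = 0")
    case True
    then have "left_part h \<noteq> 0"
      using h(2) by (auto simp: left_part_def right_part_def vec_eq_iff split_sum_all)
    then have "1 \<le> infnorm (left_part h)" using infnorm_int_vector_ge_1 int by blast
    moreover have "real N powr (- w) \<le> 1"
      using N w powr_mono[of "- w" 0 "real N"] by simp
    ultimately show ?thesis
      using True c mult_le_one[of c "real N powr (- w)"] by simp
  next
    case False
    have "infnorm (right_part h) \<le> infnorm h"
    proof -
      have "\<bar>right_part h $ i\<bar> \<le> infnorm h" for i
        using component_le_infnorm_cart[of h "Inr i"] by (simp add: right_part_def)
      then show ?thesis
        unfolding infnorm_cart[of "right_part h"] by (intro cSup_least) auto
    qed
    then have "infnorm (right_part h) \<le> real N" using h(3) by simp
    moreover have "0 < infnorm (right_part h)" using False by (simp add: infnorm_pos_lt)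
    ultimately have "real N powr (- w) \<le> infnorm (right_part h) powr (- w)"
      using w by (intro powr_mono2') auto
    then have "c * real N powr (- w) \<le> c * infnorm (right_part h) powr (- w)"
      using c by simp
    also have "\<dots> \<le> dist_int (B *v right_part h)" using B[OF int(2) False] .
    also have "\<dots> \<le> infnorm (B *v right_part h - (- left_part h))"
      by (intro dist_int_le int_vectors_uminus int)
    also have "\<dots> = infnorm (left_part h + B *v right_part h)" by (simp add: add.commute)
    finally show ?thesis .
  qed
  then show ?thesis using infnorm_le_norm order_trans by blast
qed

lemma linear_join_mult:
  fixes B :: "real ^ 'm::finite ^ 'd::finite"
  shows "linear (\<lambda>x. join_vec x (x v* B))"
  by (auto intro!: linearI simp: join_vec_def vec_eq_iff vector_matrix_mult_def algebra_simps
      sum.distrib sum_distrib_left split: sum.splits)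

lemma graph_param_eq_linear: "graph_param b B x = join_vec 0 b + join_vec x (x v* B)"
  by (auto simp: graph_param_def join_vec_def vec_eq_iff split: sum.splits)

lemma continuous_graph_param: "continuous_on S (graph_param b B)"
  unfolding graph_param_eq_linear
  by (intro continuous_intros linear_continuous_on linear_conv_bounded_linear[THEN iffD1] linear_join_mult)

lemma local_param_graph_param:
  fixes B :: "real ^ 'm::finite ^ 'd::finite"
  shows "local_param (range (graph_param b B)) UNIV (graph_param b B)
    (\<lambda>_. matrix (\<lambda>x. join_vec x (x v* B)))"
proof -
  have D: "matrix (\<lambda>x. join_vec x (x v* B)) *v h = join_vec h (h v* B)" for h
    using matrix_vector_mul(2)[OF linear_join_mult[of B], THEN fun_cong] .
  have "homeomorphism UNIV (range (graph_param b B)) (graph_param b B) left_part"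
  proof (rule homeomorphismI)
    show "continuous_on (range (graph_param b B)) left_part"
      unfolding left_part_def by (intro continuous_intros)
    show "continuous_on UNIV (graph_param b B)" by (rule continuous_graph_param)
  qed (auto simp: graph_param_def)
  moreover have "(graph_param b B has_derivative (\<lambda>h. join_vec h (h v* B))) (at u)" for u
  proof -
    have "((\<lambda>x. join_vec x (x v* B)) has_derivative (\<lambda>h. join_vec h (h v* B))) (at u)"
      by (intro linear_imp_has_derivative linear_join_mult)
    from has_derivative_add[OF has_derivative_const this, of "join_vec 0 b"] show ?thesis
      by (simp only: graph_param_eq_linear[abs_def] add_0)
  qed
  moreover have "inj (\<lambda>h. join_vec h (h v* B))"
    by (rule inj_on_inverseI[where g = left_part]) simp
  ultimately show ?thesis
    unfolding local_param_def D by (intro conjI ballI exI openin_subtopology_self open_UNIV continuous_on_const)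
qed

lemma submanifold_range_graph_param:
  fixes B :: "real ^ 'm::finite ^ 'd::finite"
  shows "submanifold TYPE('d) (range (graph_param b B))"
  unfolding submanifold_def
proof (intro ballI exI conjI)
  show "local_param (range (graph_param b B)) UNIV (graph_param b B)
      (\<lambda>_. matrix (\<lambda>x. join_vec x (x v* B)))"
    by (rule local_param_graph_param)
qed

text \<open>The set \<open>E\<close> covers \<open>S\<close> by a single piece; the constant sequence of pieces has total volume \<open>0\<close>.\<close>

lemma induced_lebesgue_eq_0:
  fixes \<phi> :: "real ^ 'd::finite \<Rightarrow> real ^ 'n::finite"
  assumes loc: "local_param M U \<phi> D" and E: "E \<in> null_sets lebesgue" "E \<subseteq> U" and S: "S \<subseteq> \<phi> ` E"
  shows "induced_lebesgue TYPE('d) M S = 0"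
proof -
  have "AE u in lebesgue. u \<notin> E" using E(1) by (rule AE_not_in)
  then have "param_volume E D = (\<integral>\<^sup>+u. 0 \<partial>(lebesgue :: (real ^ 'd) measure))"
    unfolding param_volume_def by (intro nn_integral_cong_AE) auto
  then have "(\<Sum>i::nat. param_volume E D) = 0" by simp
  moreover have "induced_lebesgue TYPE('d) M S \<le> (\<Sum>i::nat. param_volume E D)"
    unfolding induced_lebesgue_def
  proof (rule Inf_lower, clarify, intro exI conjI)
    show "(\<Sum>i::nat. param_volume E D) = (\<Sum>i. param_volume ((\<lambda>_. E) i) ((\<lambda>_. D) i))" ..
    show "\<forall>i::nat. local_param M ((\<lambda>_. U) i) ((\<lambda>_. \<phi>) i) ((\<lambda>_. D) i)
        \<and> (\<lambda>_. E) i \<in> sets lebesgue \<and> (\<lambda>_. E) i \<subseteq> U"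
      using loc E null_setsD2 by blast
    show "S \<subseteq> (\<Union>i::nat. (\<lambda>_. \<phi>) i ` (\<lambda>_. E) i)" using S by blast
  qed
  ultimately show ?thesis by simp
qed

section \<open>The approximable points form a null set\<close>

text \<open>By \<open>exp_sum_ge\<close>, for suitable \<open>N\<close> this set contains all \<open>x\<close> whose graph point, multiplied by
  \<open>q\<close>, is close to an integer vector. Unlike the set of these \<open>x\<close>, it is evidently closed,
  which gives measurability.\<close>

definition large_sum_set :: "real ^ 'm \<Rightarrow> real ^ 'm ^ 'd \<Rightarrow> nat \<Rightarrow> nat \<Rightarrow> (real ^ 'd::finite) set" where
  "large_sum_set b B q N = {x. real (N ^ CARD('d + 'm::finite)) / 2
     \<le> norm (\<Sum>k\<in>grid N. iexp (2 * pi * (k \<bullet> (real q *\<^sub>R graph_param b B x))))}"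

lemma large_sum_set_measurable: "large_sum_set b B q N \<in> sets borel"
proof -
  have "closed (large_sum_set b B q N)"
    unfolding large_sum_set_def
    by (intro closed_Collect_le continuous_intros continuous_graph_param)
  then show ?thesis by simp
qed

lemma norm_gauss_integral_shift:
  fixes v :: "'a::euclidean_space"
  shows "norm (\<integral>x. iexp (v \<bullet> x + a) \<partial>gauss) = exp (- (norm v)\<^sup>2 / 2)"
proof -
  have "(\<integral>x. iexp (v \<bullet> x + a) \<partial>gauss) = (\<integral>x. iexp a * iexp (v \<bullet> x) \<partial>gauss)"
    by (simp add: exp_add[symmetric] algebra_simps)
  also have "\<dots> = iexp a * complex_of_real (exp (- (norm v)\<^sup>2 / 2))"
    by (subst Bochner_Integration.integral_mult_right_zero) (simp only: gauss_integral_iexp)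
  finally show ?thesis by (simp add: norm_mult)
qed

lemma measure_large_sum_set_le:
  fixes B :: "real ^ 'm::finite ^ 'd::finite"
  assumes B: "\<And>j. j \<in> int_vectors \<Longrightarrow> j \<noteq> 0 \<Longrightarrow> c * infnorm j powr (- w) \<le> dist_int (B *v j)"
    and c: "0 < c" "c \<le> 1" and w: "0 < w" and N: "1 \<le> N"
  shows "measure gauss (large_sum_set b B q N)
    \<le> 4 / real (N ^ CARD('d + 'm)) + 4 * exp (- (real q * (c * real N powr (- w)))\<^sup>2)"
proof -
  interpret prob_space "gauss :: (real ^ 'd) measure" by (rule prob_space_gauss)
  define \<theta> where "\<theta> k x = 2 * pi * (k \<bullet> (real q *\<^sub>R graph_param b B x))" for k x
  define t where "t = real q * (c * real N powr (- w))"
  have off: "norm (\<integral>x. iexp (\<theta> k x - \<theta> l x) \<partial>gauss) \<le> exp (- t\<^sup>2)"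
    if k: "k \<in> grid N" and l: "l \<in> grid N" and "k \<noteq> l" for k l
  proof -
    define h where "h = k - l"
    define v where "v = (2 * pi * real q) *\<^sub>R (left_part h + B *v right_part h)"
    have h: "h \<in> int_vectors" "h \<noteq> 0" "infnorm h \<le> real N"
      using grid_diff[OF k l] \<open>k \<noteq> l\<close> by (auto simp: h_def)
    have "\<theta> k x - \<theta> l x = 2 * pi * real q * (h \<bullet> graph_param b B x)" for x
      by (simp add: \<theta>_def h_def algebra_simps)
    then have "\<theta> k x - \<theta> l x = v \<bullet> x + 2 * pi * real q * (right_part h \<bullet> b)" for x
      by (simp add: inner_graph_param v_def algebra_simps)
    then have eq: "norm (\<integral>x. iexp (\<theta> k x - \<theta> l x) \<partial>gauss) = exp (- (norm v)\<^sup>2 / 2)"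
      by (simp only: norm_gauss_integral_shift)
    \<comment> \<open>The crude bound \<open>2 \<le> 2 \<pi>\<close> leaves \<open>(2 t)\<^sup>2 / 2 \<ge> t\<^sup>2\<close> in the exponent.\<close>
    have "2 * t \<le> (2 * pi) * t"
      using pi_gt3 c by (intro mult_right_mono) (auto simp: t_def)
    also have "\<dots> \<le> norm v"
      using norm_frequency_ge[OF B c w h]
      by (simp add: v_def t_def mult.assoc mult_left_mono)
    finally have "2 * t \<le> norm v" .
    moreover have "0 \<le> t" using c by (simp add: t_def)
    ultimately have "(2 * t)\<^sup>2 \<le> (norm v)\<^sup>2" by (intro power_mono) auto
    then have "4 * t\<^sup>2 \<le> (norm v)\<^sup>2" by (simp add: power_mult_distrib)
    then have "t\<^sup>2 \<le> (norm v)\<^sup>2 / 2" using zero_le_power2[of t] by linarith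
    then show ?thesis unfolding eq by simp
  qed
  have meas: "\<theta> k \<in> borel_measurable gauss" for k
  proof -
    have "continuous_on UNIV (\<theta> k)"
      unfolding \<theta>_def by (intro continuous_intros continuous_graph_param)
    then show ?thesis
      by (subst measurable_cong_sets[OF sets_gauss refl]) (rule borel_measurable_continuous_onI)
  qed
  have "(grid N :: (real ^ ('d + 'm)) set) \<noteq> {}"
    using N card_grid[of N, where ?'n = "'d + 'm"] by (metis card.empty not_one_le_zero power_not_zero)
  then have "measure gauss {x\<in>space gauss. real (card (grid N :: (real ^ ('d + 'm)) set)) / 2
        \<le> norm (\<Sum>k\<in>grid N. iexp (\<theta> k x))}
      \<le> 4 / real (card (grid N :: (real ^ ('d + 'm)) set)) + 4 * exp (- t\<^sup>2)"
    by (intro mean_square_bound finite_grid meas off) auto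
  then show ?thesis
    unfolding card_grid large_sum_set_def \<theta>_def t_def space_gauss by simp
qed

text \<open>With \<open>N = \<lfloor>1 / r\<rfloor>\<close> the diagonal contribution becomes a power of \<open>r\<close>. For \<open>r > 1\<close>, where \<open>N = 0\<close>, the
  bound exceeds \<open>1\<close> and holds trivially.\<close>

lemma measure_large_sum_set_le_radius:
  fixes B :: "real ^ 'm::finite ^ 'd::finite"
  assumes B: "\<And>j. j \<in> int_vectors \<Longrightarrow> j \<noteq> 0 \<Longrightarrow> c * infnorm j powr (- w) \<le> dist_int (B *v j)"
    and c: "0 < c" "c \<le> 1" and w: "0 < w"
    and r: "0 < r" and q: "1 \<le> q" "1 / r \<le> real q powr \<kappa>"
  shows "measure gauss (large_sum_set b B q (nat \<lfloor>1 / r\<rfloor>))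
    \<le> 4 * (2 * r) ^ CARD('d + 'm) + 4 * exp (- (c * real q powr (1 - w * \<kappa>))\<^sup>2)"
proof (cases "r \<le> 1")
  case False
  interpret prob_space "gauss :: (real ^ 'd) measure" by (rule prob_space_gauss)
  have "1 \<le> (2 * r) ^ CARD('d + 'm)" using False by (intro one_le_power) auto
  moreover have "measure gauss (large_sum_set b B q (nat \<lfloor>1 / r\<rfloor>)) \<le> 1" by (rule prob_le_1)
  moreover have "0 \<le> exp (- (c * real q powr (1 - w * \<kappa>))\<^sup>2)" by simp
  ultimately show ?thesis by linarith
next
  case True
  define N where "N = nat \<lfloor>1 / r\<rfloor>"
  have "1 \<le> 1 / r" using True r by simp
  then have fl: "1 \<le> \<lfloor>1 / r\<rfloor>" by simp
  then have int_N: "int N = \<lfloor>1 / r\<rfloor>" unfolding N_def by linarith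
  then have "real N = of_int \<lfloor>1 / r\<rfloor>" by (metis of_int_of_nat_eq)
  moreover have "1 \<le> N" using fl int_N by linarith
  ultimately have N: "1 \<le> N" "real N \<le> 1 / r" "1 / r \<le> 2 * real N"
    using real_of_int_floor_add_one_gt[of "1 / r"] of_int_floor_le[of "1 / r"] by linarith+
  have "1 / real (N ^ CARD('d + 'm)) = (1 / real N) ^ CARD('d + 'm)"
    by (simp add: power_divide)
  also have "\<dots> \<le> (2 * r) ^ CARD('d + 'm)"
    using N r by (intro power_mono) (auto simp: field_simps)
  finally have main: "4 / real (N ^ CARD('d + 'm)) \<le> 4 * (2 * r) ^ CARD('d + 'm)" by simp
  have "real q powr (1 - w * \<kappa>) = real q * (real q powr \<kappa>) powr (- w)"
    using q by (simp add: powr_powr powr_diff powr_minus field_simps)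
  also have "\<dots> \<le> real q * real N powr (- w)"
    using N q w by (intro mult_left_mono powr_mono2') auto
  finally have "c * real q powr (1 - w * \<kappa>) \<le> real q * (c * real N powr (- w))"
    using c by (simp add: mult.left_commute)
  then have "(c * real q powr (1 - w * \<kappa>))\<^sup>2 \<le> (real q * (c * real N powr (- w)))\<^sup>2"
    using c by (intro power_mono) auto
  then have "exp (- (real q * (c * real N powr (- w)))\<^sup>2) \<le> exp (- (c * real q powr (1 - w * \<kappa>))\<^sup>2)"
    by simp
  then show ?thesis
    using main measure_large_sum_set_le[OF B c w N(1), of b q] unfolding N_def by linarith
qed

lemma summable_exp_neg_powr:
  assumes "0 < c" "0 < \<eta>"
  shows "summable (\<lambda>q. exp (- (c * real q powr \<eta>)\<^sup>2))"
proof (rule summable_comparison_test_bigo)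
  show "summable (\<lambda>q. norm (real q powr (- 2)))"
    by (simp add: summable_real_powr_iff)
  show "(\<lambda>q. exp (- (c * real q powr \<eta>)\<^sup>2)) \<in> O(\<lambda>q. real q powr (- 2))"
    using assms by real_asymp
qed

text \<open>Borel--Cantelli for the sets \<open>large_sum_set\<close>. The lower bound \<open>q powr (- \<kappa>)\<close> built into \<open>\<delta>\<close> keeps
  the box side \<open>N\<close> below \<open>q powr \<kappa>\<close>, so that the off-diagonal frequencies grow with \<open>q\<close>. The two
  conditions on \<open>\<kappa>\<close> are compatible because \<open>w < n\<close>: \<open>\<kappa> > 1 / n\<close> keeps \<open>\<Sum> \<delta>(q)\<^sup>n\<close> finite and
  \<open>\<kappa> < 1 / w\<close> makes \<open>1 - w \<kappa>\<close> positive.\<close>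

lemma null_set_graph_param_approximable:
  fixes B :: "real ^ 'm::finite ^ 'd::finite"
  assumes exponent: "diophantine_exponent B < ereal (real CARD('d + 'm))"
    and \<psi>: "\<And>q. 0 \<le> \<psi> q" "summable (\<lambda>q. \<psi> q ^ CARD('d + 'm))"
  shows "{x. graph_param b B x \<in> approximable \<psi>} \<in> null_sets lebesgue"
proof -
  interpret prob_space "gauss :: (real ^ 'd) measure" by (rule prob_space_gauss)
  define n where "n = CARD('d + 'm)"
  have n: "0 < n" unfolding n_def by (rule zero_less_card_finite)
  obtain w c where w: "0 < w" "w < real n" and c: "0 < c" "c \<le> 1"
    and B: "\<And>j. j \<in> int_vectors \<Longrightarrow> j \<noteq> 0 \<Longrightarrow> c * infnorm j powr (- w) \<le> dist_int (B *v j)"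
    using exponent_less_imp_dist_int_ge[OF exponent[folded n_def]] n by (metis of_nat_0_less_iff)
  have "1 / real n < 1 / w" using w n by (simp add: field_simps)
  then obtain \<kappa> where "1 / real n < \<kappa>" "\<kappa> < 1 / w" using dense by blast
  then have \<kappa>: "1 < \<kappa> * real n" "w * \<kappa> < 1" using n w by (simp_all add: field_simps)
  define \<delta> where "\<delta> q = max (\<psi> q) (real q powr (- \<kappa>))" for q
  \<comment> \<open>The factor \<open>6 n\<close> is the one required by \<open>exp_sum_ge\<close> with \<open>N = \<lfloor>1 / r\<rfloor>\<close>.\<close>
  define r where "r q = 6 * real n * \<delta> q" for q
  define N where "N q = nat \<lfloor>1 / r q\<rfloor>" for q
  have r: "0 < r q" "1 / r q \<le> real q powr \<kappa>" if "1 \<le> q" for q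
  proof -
    have p: "0 < real q powr (- \<kappa>)" using that by simp
    have "real q powr (- \<kappa>) \<le> 1 * \<delta> q" by (simp add: \<delta>_def)
    also have "1 * \<delta> q \<le> r q"
      unfolding r_def using n p by (intro mult_right_mono) (auto simp: \<delta>_def le_max_iff_disj)
    finally have "real q powr (- \<kappa>) \<le> r q" .
    with p show "0 < r q" by linarith
    with \<open>real q powr (- \<kappa>) \<le> r q\<close> p show "1 / r q \<le> real q powr \<kappa>"
      by (simp add: powr_minus field_simps)
  qed
  have bound: "measure gauss (large_sum_set b B q (N q)) \<le>
      4 * (12 * real n) ^ n * (\<psi> q ^ n + real q powr (- \<kappa> * real n))
      + 4 * exp (- (c * real q powr (1 - w * \<kappa>))\<^sup>2)" if "1 \<le> q" for q
  proof -
    have "\<delta> q ^ n \<le> \<psi> q ^ n + (real q powr (- \<kappa>)) ^ n"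
      using \<psi>(1)[of q] by (auto simp: \<delta>_def max_def)
    also have "(real q powr (- \<kappa>)) ^ n = real q powr (- \<kappa> * real n)"
      using that by (simp add: powr_realpow[symmetric] powr_powr)
    finally have "4 * (12 * real n) ^ n * \<delta> q ^ n
        \<le> 4 * (12 * real n) ^ n * (\<psi> q ^ n + real q powr (- \<kappa> * real n))"
      by (intro mult_left_mono) auto
    moreover have "2 * r q = (12 * real n) * \<delta> q" by (simp add: r_def)
    then have "4 * (2 * r q) ^ n = 4 * (12 * real n) ^ n * \<delta> q ^ n"
      by (simp only: power_mult_distrib mult.assoc)
    ultimately show ?thesis
      using measure_large_sum_set_le_radius[OF B c w(1) r(1)[OF that] that r(2)[OF that], of b]
      unfolding N_def n_def by linarith
  qed
  have "summable (\<lambda>q. measure gauss (large_sum_set b B q (N q)))"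
  proof (rule summable_comparison_test_ev)
    show "\<forall>\<^sub>F q in sequentially. norm (measure gauss (large_sum_set b B q (N q))) \<le>
      4 * (12 * real n) ^ n * (\<psi> q ^ n + real q powr (- \<kappa> * real n))
      + 4 * exp (- (c * real q powr (1 - w * \<kappa>))\<^sup>2)"
      using bound by (intro eventually_sequentiallyI[of 1]) simp
    have "summable (\<lambda>q. real q powr (- \<kappa> * real n))"
      using \<kappa>(1) by (simp add: summable_real_powr_iff)
    moreover have "summable (\<lambda>q. exp (- (c * real q powr (1 - w * \<kappa>))\<^sup>2))"
      using c \<kappa>(2) by (intro summable_exp_neg_powr) auto
    ultimately show "summable (\<lambda>q. 4 * (12 * real n) ^ n * (\<psi> q ^ n + real q powr (- \<kappa> * real n))
      + 4 * exp (- (c * real q powr (1 - w * \<kappa>))\<^sup>2))"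
      using \<psi>(2) unfolding n_def by (intro summable_add summable_mult)
  qed
  then have "AE x in gauss. \<forall>\<^sub>F q in sequentially. x \<in> space gauss - large_sum_set b B q (N q)"
    using large_sum_set_measurable by (intro borel_cantelli_AE1) (auto simp: emeasure_eq_measure)
  moreover have "graph_param b B x \<notin> approximable \<psi>"
    if ev: "\<forall>\<^sub>F q in sequentially. x \<in> space gauss - large_sum_set b B q (N q)" for x
  proof -
    obtain q0 where q0: "\<And>q. q0 \<le> q \<Longrightarrow> x \<notin> large_sum_set b B q (N q)"
      using ev unfolding eventually_sequentially by auto
    have "q < q0" if q: "1 \<le> q" and d: "dist_int (real q *\<^sub>R graph_param b B x) < \<psi> q" for q
    proof -
      have d: "dist_int (real q *\<^sub>R graph_param b B x) < \<delta> q"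
        using d by (simp add: \<delta>_def)
      have "real (N q) \<le> 1 / r q" using r(1)[OF q] by (simp add: N_def)
      then have "real n * real (N q) * \<delta> q \<le> 1 / 6"
        using r(1)[OF q] by (simp add: r_def field_simps)
      then have "x \<in> large_sum_set b B q (N q)"
        using exp_sum_ge[OF d] by (simp add: large_sum_set_def n_def)
      then show ?thesis using q0 not_le by blast
    qed
    then have "{q. q \<ge> 1 \<and> dist_int (real q *\<^sub>R graph_param b B x) < \<psi> q} \<subseteq> {..<q0}" by auto
    then show ?thesis unfolding approximable_def using finite_subset by blast
  qed
  ultimately have "AE x in lborel. graph_param b B x \<notin> approximable \<psi>"
    unfolding AE_gauss_iff by (auto elim: eventually_mono)
  then have "AE x in lebesgue. graph_param b B x \<notin> approximable \<psi>" by (rule AE_completion)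
  then obtain E where "{x. graph_param b B x \<in> approximable \<psi>} \<subseteq> E" "E \<in> null_sets lebesgue"
    by (auto simp: eventually_ae_filter)
  then show ?thesis by (rule null_sets_completion_subset)
qed

theorem theorem2p3:
  fixes \<beta> :: "real ^ 'm::finite"
    and A' :: "real ^ 'm ^ 'd::finite"
    and A :: "real ^ 'm ^ ('d option)"
  assumes "A = add_top_row \<beta> A'"
    and "diophantine_exponent A' < ereal (real (CARD('d) + CARD('m)))"
  shows "strong_khintchine_convergence TYPE('d) (affine_graph A)"
proof -
  have M: "affine_graph A = range (graph_param \<beta> A')"
    unfolding assms(1) by (rule affine_graph_eq)
  have exponent: "diophantine_exponent A' < ereal (real CARD('d + 'm))"
    using assms(2) by simp
  show ?thesis
    unfolding strong_khintchine_convergence_def M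
  proof (intro conjI allI impI)
    show "submanifold TYPE('d) (range (graph_param \<beta> A'))"
      by (rule submanifold_range_graph_param)
    fix \<psi> :: "nat \<Rightarrow> real"
    assume \<psi>: "(\<forall>q. 0 \<le> \<psi> q) \<and> summable (\<lambda>q. \<psi> q ^ CARD('d + 'm))"
    show "induced_lebesgue TYPE('d) (range (graph_param \<beta> A'))
        (approximable \<psi> \<inter> range (graph_param \<beta> A')) = 0"
    proof (rule induced_lebesgue_eq_0[OF local_param_graph_param])
      show "{x. graph_param \<beta> A' x \<in> approximable \<psi>} \<in> null_sets lebesgue"
        using \<psi> by (intro null_set_graph_param_approximable[OF exponent]) auto
    qed auto
  qed
qed

end
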